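(* Let $n\geq 1$, $m\geq 1$ and $k_f,k_b\geq 0$ be integers, and put $k=2k_f+2k_b$ and $v=(k_f^2+k_b^2+1)\cdot(2k_fk_b+1)$. If \[ k^2\cdot v\cdot \lg(n+1) \;+\; k\cdot v\cdot \lg m \;+\; v\cdot(1+\lg v) \;\leq\; n, \] then the problem $\mathit{Disj}_n$ cannot be solved by any mp2s-automaton with parameters $(\mathbb{D}_n,m,k_f,k_b)$ (i.e., with $m$ states, $k_f$ forward heads and $k_b$ backward heads on each of the two input streams). Here $\lg$ denotes the logarithm to base 2.
   Context: Let $\mathbb{D}$ be a set and let $m,k_f,k_b$ be integers with $m\geq 1$ and $k_f,k_b\geq 0$. An mp2s-automaton with parameters $(\mathbb{D},m,k_f,k_b)$ receives as input two finite strings (streams) $S=s_1\cdots s_{|S|}\in\mathbb{D}^*$ and $T=t_1\cdots t_{|T|}\in\mathbb{D}^*$. It has a finite state set $Q$ with $|Q|=m$, a designated start state, and a set $F\subseteq Q$ of accepting states. On each of the two streams it has $k_f$ forward heads and $k_b$ backward heads; $k=2k_f+2k_b$ is the total number of heads. Initially the automaton is in the start state, all forward heads on $S$ (resp. $T$) are on $s_1$ (resp. $t_1$), and all backward heads on $S$ (resp. $T$) are on $s_{|S|}$ (resp. $t_{|T|}$). A deterministic transition function $\delta: Q\times(\mathbb{D}\cup\{\mathit{end}\})^k\to Q\times\{\mathit{advance},\mathit{stay}\}^k$ maps the current state and the symbols under the $k$ heads to the next state and, for each head, whether it is advanced (forward heads move one position right, backward heads one position left) or stays; the symbol $\mathit{end}\notin\mathbb{D}$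 is read by a head that has moved beyond the end of its stream (past the rightmost element for a forward head, past the leftmost element for a backward head). Heads move asynchronously. The computation ends as soon as every head has passed its entire stream; the input is accepted iff the state at that moment is in $F$. For an integer $n\geq 1$, let $\mathbb{D}_n=\{a_1,b_1,\ldots,a_n,b_n\}$ be a fixed set of $2n$ distinct data items. The problem $\mathit{Disj}_n$: given streams $S,T$ over $\mathbb{D}_n$ with $|S|=|T|=n$, decide whether the sets $\{s_1,\ldots,s_n\}$ and $\{t_1,\ldots,t_n\}$ are disjoint. An mp2s-automaton solves $\mathit{Disj}_n$ if for all $S,T\in\mathbb{D}_n^*$ with $|S|=|T|=n$ it accepts $(S,T)$ if and only if these two sets are disjoint. *)

theory Defs
  imports Complex_Main "HOL-Library.FuncSet"
begin

datatype stream = Stream_S | Stream_T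
datatype direction = Forward | Backward
datatype move = Advance | Stay

text \<open>A head is given by its stream, its direction and its number among the heads of that
  stream and direction.\<close>

type_synonym head = "stream \<times> direction \<times> nat"

definition heads :: "nat \<Rightarrow> nat \<Rightarrow> head set" where
  "heads kf kb = UNIV \<times> ({Forward} \<times> {..<kf} \<union> {Backward} \<times> {..<kb})"

text \<open>The symbol \<open>end\<close> is represented by \<open>None\<close>. A vector of \<open>k\<close> symbols or moves is an
  extensional function on the set of heads, which has \<open>2 * kf + 2 * kb\<close> elements.\<close>

definition symbols :: "'d set \<Rightarrow> 'd option set" where
  "symbols D = insert None (Some ` D)"

record ('q, 'd) mp2s =
  states :: "'q set"
  start :: "'q"
  accepting :: "'q set"
  trans_fun :: "'q \<times> (head \<Rightarrow> 'd option) \<Rightarrow> 'q \<times> (head \<Rightarrow> move)"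

definition mp2s_automaton ::
  "'d set \<Rightarrow> nat \<Rightarrow> nat \<Rightarrow> nat \<Rightarrow> ('q, 'd) mp2s \<Rightarrow> bool" where
  "mp2s_automaton D m kf kb M \<longleftrightarrow>
     finite (states M) \<and> card (states M) = m \<and>
     start M \<in> states M \<and> accepting M \<subseteq> states M \<and>
     trans_fun M \<in> states M \<times> (heads kf kb \<rightarrow>\<^sub>E symbols D) \<rightarrow>
                   states M \<times> (heads kf kb \<rightarrow>\<^sub>E UNIV)"

text \<open>On a stream \<open>w\<close> the items occupy the positions \<open>1, \<dots>, length w\<close>. Position
  \<open>length w + 1\<close> is the one beyond the end for forward heads, position \<open>0\<close> the one for
  backward heads; a head that has arrived there remains there.\<close>

fun init_pos :: "direction \<Rightarrow> 'd list \<Rightarrow> nat" where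
  "init_pos Forward w = 1"
| "init_pos Backward w = length w"

fun passed :: "direction \<Rightarrow> 'd list \<Rightarrow> nat \<Rightarrow> bool" where
  "passed Forward w p \<longleftrightarrow> p > length w"
| "passed Backward w p \<longleftrightarrow> p = 0"

definition symbol_at :: "direction \<Rightarrow> 'd list \<Rightarrow> nat \<Rightarrow> 'd option" where
  "symbol_at d w p = (if passed d w p then None else Some (w ! (p - 1)))"

definition next_pos :: "direction \<Rightarrow> 'd list \<Rightarrow> move \<Rightarrow> nat \<Rightarrow> nat" where
  "next_pos d w mv p =
     (if mv = Stay \<or> passed d w p then p
      else case d of Forward \<Rightarrow> p + 1 | Backward \<Rightarrow> p - 1)"

fun stream_of :: "'d list \<Rightarrow> 'd list \<Rightarrow> stream \<Rightarrow> 'd list" where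
  "stream_of S T Stream_S = S"
| "stream_of S T Stream_T = T"

type_synonym 'q config = "'q \<times> (head \<Rightarrow> nat)"

definition init_config ::
  "nat \<Rightarrow> nat \<Rightarrow> ('q, 'd) mp2s \<Rightarrow> 'd list \<Rightarrow> 'd list \<Rightarrow> 'q config" where
  "init_config kf kb M S T =
     (start M, \<lambda>(s, d, i)\<in>heads kf kb. init_pos d (stream_of S T s))"

definition read_symbols ::
  "nat \<Rightarrow> nat \<Rightarrow> 'd list \<Rightarrow> 'd list \<Rightarrow> (head \<Rightarrow> nat) \<Rightarrow> head \<Rightarrow> 'd option" where
  "read_symbols kf kb S T pos =
     (\<lambda>(s, d, i)\<in>heads kf kb. symbol_at d (stream_of S T s) (pos (s, d, i)))"

definition step ::
  "nat \<Rightarrow> nat \<Rightarrow> ('q, 'd) mp2s \<Rightarrow> 'd list \<Rightarrow> 'd list \<Rightarrow> 'q config \<Rightarrow> 'q config" where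
  "step kf kb M S T c =
     (let (q, pos) = c;
          (q', mv) = trans_fun M (q, read_symbols kf kb S T pos)
      in (q', \<lambda>(s, d, i)\<in>heads kf kb.
                next_pos d (stream_of S T s) (mv (s, d, i)) (pos (s, d, i))))"

definition final_config ::
  "nat \<Rightarrow> nat \<Rightarrow> 'd list \<Rightarrow> 'd list \<Rightarrow> 'q config \<Rightarrow> bool" where
  "final_config kf kb S T c \<longleftrightarrow>
     (\<forall>(s, d, i)\<in>heads kf kb. passed d (stream_of S T s) (snd c (s, d, i)))"

definition config_at ::
  "nat \<Rightarrow> nat \<Rightarrow> ('q, 'd) mp2s \<Rightarrow> 'd list \<Rightarrow> 'd list \<Rightarrow> nat \<Rightarrow> 'q config" where
  "config_at kf kb M S T t = (step kf kb M S T ^^ t) (init_config kf kb M S T)"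

text \<open>The computation ends at the first final configuration; an input on which no final
  configuration is ever reached is not accepted.\<close>

definition accepts ::
  "nat \<Rightarrow> nat \<Rightarrow> ('q, 'd) mp2s \<Rightarrow> 'd list \<Rightarrow> 'd list \<Rightarrow> bool" where
  "accepts kf kb M S T \<longleftrightarrow>
     (\<exists>t. final_config kf kb S T (config_at kf kb M S T t) \<and>
          (\<forall>u<t. \<not> final_config kf kb S T (config_at kf kb M S T u)) \<and>
          fst (config_at kf kb M S T t) \<in> accepting M)"

datatype item = Item_a nat | Item_b nat

definition disj_items :: "nat \<Rightarrow> item set" where
  "disj_items n = Item_a ` {1..n} \<union> Item_b ` {1..n}"

definition solves_disj :: "nat \<Rightarrow> nat \<Rightarrow> nat \<Rightarrow> ('q, item) mp2s \<Rightarrow> bool" where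
  "solves_disj n kf kb M \<longleftrightarrow>
     (\<forall>S\<in>lists (disj_items n). \<forall>T\<in>lists (disj_items n).
        length S = n \<and> length T = n \<longrightarrow>
        (accepts kf kb M S T \<longleftrightarrow> set S \<inter> set T = {}))"

end

theory Submission imports Defs begin

text \<open>Cut the streams into \<open>v = p * q\<close> blocks, with \<open>p = kf\<^sup>2 + kb\<^sup>2 + 1\<close> rows of
  \<open>q = 2 * kf * kb + 1\<close> blocks each; \<open>T\<close> contains the items complementary to those of \<open>S\<close>, with the
  rows in reverse order. A pair of heads, one on each stream, checks a block if at some moment both
  heads are in it. A pair moving in the same direction can only check blocks of one row, and a pair
  moving in opposite directions can check at most one block of each row; so some row is missed by all
  pairs of the first kind, and some block of that row is missed by all pairs.

  By counting, two of the \<open>2 ^ n\<close> inputs miss the same block, agree outside of it, and have the same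
  configurations at the moments when the heads enter it. In the input composed of the first \<open>S\<close> and
  the second \<open>T\<close>, the automaton follows the first run as long as no head on \<open>T\<close> is in the block and
  the second run as long as no head on \<open>S\<close> is, and it changes over at common entry
  configurations. Hence it accepts, although the two streams share an item.\<close>

section \<open>Alternating between two runs\<close>

text \<open>Run \<open>x\<close> is followed while \<open>ok x\<close> holds. Every change of run lowers the potential, so the
  simulation cannot alternate forever.\<close>

lemma alternating_simulation:
  fixes \<rho> :: "'x \<Rightarrow> nat \<Rightarrow> 'c" and \<Phi> :: "'c \<Rightarrow> nat"
  assumes follow: "\<And>x t. t < tf x \<Longrightarrow> ok x (\<rho> x t) \<Longrightarrow> g (\<rho> x t) = \<rho> x (Suc t)"
    and not_final: "\<And>x t. t < tf x \<Longrightarrow> \<not> final (\<rho> x t)"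
    and final: "\<And>x. final (\<rho> x (tf x))" and acc: "\<And>x. acc (\<rho> x (tf x))"
    and decreasing: "\<And>x t. t < tf x \<Longrightarrow> \<Phi> (\<rho> x (Suc t)) \<le> \<Phi> (\<rho> x t)"
    and switch: "\<And>x t. t < tf x \<Longrightarrow> ok x (\<rho> x t) \<Longrightarrow> \<not> ok x (\<rho> x (Suc t)) \<Longrightarrow>
      \<Phi> (\<rho> x (Suc t)) < \<Phi> (\<rho> x t) \<and>
      (\<exists>y t'. t' \<le> tf y \<and> \<rho> x (Suc t) = \<rho> y t' \<and> ok y (\<rho> x (Suc t)))"
    and "t \<le> tf x" and "ok x (\<rho> x t)"
  shows "\<exists>u. final ((g ^^ u) (\<rho> x t)) \<and> acc ((g ^^ u) (\<rho> x t)) \<and>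
             (\<forall>j<u. \<not> final ((g ^^ j) (\<rho> x t)))"
  using \<open>t \<le> tf x\<close> \<open>ok x (\<rho> x t)\<close>
\<comment> \<open>Following a run shortens the time left in it. A change of run may lengthen that
  time but lowers the potential, which is therefore compared first.\<close>
proof (induction "(\<Phi> (\<rho> x t), tf x - t)" arbitrary: x t
    rule: wf_induct_rule[OF wf_lex_prod[OF wf_less_than wf_less_than]])
  case (1 x t)
  show ?case
  proof (cases "t = tf x")
    case True
    then show ?thesis using final acc by (intro exI[of _ 0]) auto
  next
    case False
    then have t: "t < tf x" using 1 by simp
    have g: "g (\<rho> x t) = \<rho> x (Suc t)" using follow t 1 by blast
    have "\<exists>y t'. t' \<le> tf y \<and> \<rho> x (Suc t) = \<rho> y t' \<and> ok y (\<rho> y t') \<and>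
        ((\<Phi> (\<rho> y t'), tf y - t'), (\<Phi> (\<rho> x t), tf x - t)) \<in> less_than <*lex*> less_than"
    proof (cases "ok x (\<rho> x (Suc t))")
      case True
      then show ?thesis using t decreasing[OF t]
        by (intro exI[of _ x] exI[of _ "Suc t"]) auto
    next
      case False
      then show ?thesis using switch[OF t] 1 by (metis in_lex_prod less_than_iff)
    qed
    then obtain y t' where y: "t' \<le> tf y" "\<rho> x (Suc t) = \<rho> y t'" "ok y (\<rho> y t')"
      "((\<Phi> (\<rho> y t'), tf y - t'), (\<Phi> (\<rho> x t), tf x - t)) \<in> less_than <*lex*> less_than"
      by blast
    obtain u where u: "final ((g ^^ u) (\<rho> y t'))" "acc ((g ^^ u) (\<rho> y t'))"
      "\<forall>j<u. \<not> final ((g ^^ j) (\<rho> y t'))"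
      using 1(1)[OF y(4) y(1) y(3)] by blast
    have shift: "(g ^^ Suc j) (\<rho> x t) = (g ^^ j) (\<rho> y t')" for j
      using g y(2) by (simp add: funpow_swap1)
    have "\<forall>j<Suc u. \<not> final ((g ^^ j) (\<rho> x t))"
    proof (intro allI impI)
      fix j assume "j < Suc u"
      then show "\<not> final ((g ^^ j) (\<rho> x t))"
        using u(3) shift not_final[OF t] by (cases j) auto
    qed
    then show ?thesis using u shift by metis
  qed
qed

section \<open>Head positions along a run\<close>

fun pos_range :: "nat \<Rightarrow> direction \<Rightarrow> nat set" where
  "pos_range n Forward = {1..n + 1}"
| "pos_range n Backward = {0..n}"

fun behind :: "direction \<Rightarrow> nat \<Rightarrow> nat \<Rightarrow> bool" where
  "behind Forward a b \<longleftrightarrow> a \<le> b"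
| "behind Backward a b \<longleftrightarrow> b \<le> a"

fun distance_left :: "nat \<Rightarrow> direction \<Rightarrow> nat \<Rightarrow> nat" where
  "distance_left n Forward a = n + 1 - a"
| "distance_left n Backward a = a"

text \<open>A finite set containing all reachable configurations; its cardinality enters the final
  count.\<close>

definition configs :: "nat \<Rightarrow> 'q set \<Rightarrow> nat \<Rightarrow> nat \<Rightarrow> 'q config set" where
  "configs n Q kf kb = Q \<times> (\<Pi>\<^sub>E h\<in>heads kf kb. pos_range n (fst (snd h)))"

lemma card_pos_range [simp]: "card (pos_range n d) = n + 1"
  by (cases d) auto

lemma finite_pos_range [simp]: "finite (pos_range n d)"
  by (cases d) auto

lemma UNIV_stream: "(UNIV :: stream set) = {Stream_S, Stream_T}"
  using stream.exhaust by auto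

lemma finite_heads [simp]: "finite (heads kf kb)"
  by (simp add: heads_def UNIV_stream)

lemma card_heads: "card (heads kf kb) = 2 * kf + 2 * kb"
proof -
  have "card ({Forward} \<times> {..<kf} \<union> {Backward} \<times> {..<kb}) = kf + kb"
    by (subst card_Un_disjoint) (auto simp: card_cartesian_product)
  then show ?thesis by (simp add: heads_def UNIV_stream card_cartesian_product)
qed

lemma finite_configs: "finite Q \<Longrightarrow> finite (configs n Q kf kb)"
  by (simp add: configs_def finite_PiE)

lemma card_configs: "card (configs n Q kf kb) = card Q * (n + 1) ^ (2 * kf + 2 * kb)"
  by (simp add: configs_def card_cartesian_product card_PiE card_heads)

lemma configs_pos:
  "c \<in> configs n Q kf kb \<Longrightarrow> (s, d, i) \<in> heads kf kb \<Longrightarrow> snd c (s, d, i) \<in> pos_range n d"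
  by (force simp: configs_def PiE_iff)

lemma behind_trans: "behind d a b \<Longrightarrow> behind d b c \<Longrightarrow> behind d a c"
  by (cases d) auto

lemma behind_next_pos: "behind d a (next_pos d w mv a)"
  by (cases d) (auto simp: next_pos_def)

lemma next_pos_in_range:
  "a \<in> pos_range (length w) d \<Longrightarrow> next_pos d w mv a \<in> pos_range (length w) d"
  by (cases d) (auto simp: next_pos_def)

lemma passed_cong: "length w = length w' \<Longrightarrow> passed d w a = passed d w' a"
  by (cases d) auto

lemma next_pos_cong: "length w = length w' \<Longrightarrow> next_pos d w mv a = next_pos d w' mv a"
  using passed_cong[of w w'] by (simp add: next_pos_def)

lemma distance_left_mono: "behind d a b \<Longrightarrow> distance_left n d b \<le> distance_left n d a"
  by (cases d) auto

lemma distance_left_strict_mono: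
  "behind d a b \<Longrightarrow> a \<noteq> b \<Longrightarrow> b \<in> pos_range n d \<Longrightarrow> distance_left n d b < distance_left n d a"
  by (cases d) auto

lemma not_passed_range:
  "a \<in> pos_range (length w) d \<Longrightarrow> \<not> passed d w a \<Longrightarrow> a \<in> {1..length w}"
  by (cases d) auto

lemma fst_step:
  "fst (step kf kb M S T c) = fst (trans_fun M (fst c, read_symbols kf kb S T (snd c)))"
  by (simp add: step_def split: prod.splits)

lemma snd_step:
  "snd (step kf kb M S T c) = (\<lambda>(s, d, i)\<in>heads kf kb. next_pos d (stream_of S T s)
     (snd (trans_fun M (fst c, read_symbols kf kb S T (snd c))) (s, d, i)) (snd c (s, d, i)))"
  by (simp add: step_def split: prod.splits)

lemma config_at_Suc: "config_at kf kb M S T (Suc t) = step kf kb M S T (config_at kf kb M S T t)"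
  by (simp add: config_at_def)

lemma length_stream_of:
  "length S = n \<Longrightarrow> length T = n \<Longrightarrow> length (stream_of S T s) = n"
  by (cases s) auto

lemma stream_of_in_lists: "S \<in> lists D \<Longrightarrow> T \<in> lists D \<Longrightarrow> stream_of S T s \<in> lists D"
  by (cases s) auto

lemma read_symbols_in:
  assumes "S \<in> lists D" "T \<in> lists D" "length S = n" "length T = n"
    and c: "c \<in> configs n Q kf kb"
  shows "read_symbols kf kb S T (snd c) \<in> heads kf kb \<rightarrow>\<^sub>E symbols D"
proof (rule PiE_I)
  fix h assume h: "h \<in> heads kf kb"
  obtain s d i where h_eq: "h = (s, d, i)" by (cases h) auto
  let ?w = "stream_of S T s"
  have "snd c h \<in> pos_range (length ?w) d"
    using configs_pos[OF c] h h_eq length_stream_of[OF assms(3,4)] by simp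
  \<comment> \<open>A head that has not passed its stream is at a position from 1 to the length, so
    subtracting 1 gives a valid index.\<close>
  then have "\<not> passed d ?w (snd c h) \<Longrightarrow> ?w ! (snd c h - 1) \<in> set ?w"
    by (metis One_nat_def Suc_pred atLeastAtMost_iff less_eq_Suc_le not_passed_range nth_mem)
  then show "read_symbols kf kb S T (snd c) h \<in> symbols D"
    using h h_eq stream_of_in_lists[OF assms(1,2), of s]
    by (auto simp: read_symbols_def symbols_def symbol_at_def)
qed (auto simp: read_symbols_def)

lemma step_in_configs:
  assumes "mp2s_automaton D m kf kb M"
    and "S \<in> lists D" "T \<in> lists D" and len: "length S = n" "length T = n"
    and c: "c \<in> configs n (states M) kf kb"
  shows "step kf kb M S T c \<in> configs n (states M) kf kb"
proof -
  have "fst (step kf kb M S T c) \<in> states M"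
  proof -
    have "(fst c, read_symbols kf kb S T (snd c)) \<in> states M \<times> (heads kf kb \<rightarrow>\<^sub>E symbols D)"
      using read_symbols_in[OF assms(2-)] c by (auto simp: configs_def)
    then have "trans_fun M (fst c, read_symbols kf kb S T (snd c)) \<in> states M \<times> (heads kf kb \<rightarrow>\<^sub>E UNIV)"
      using assms(1) unfolding mp2s_automaton_def by blast
    then show ?thesis by (auto simp: fst_step)
  qed
  moreover have "snd (step kf kb M S T c) \<in> (\<Pi>\<^sub>E h\<in>heads kf kb. pos_range n (fst (snd h)))"
  proof (rule PiE_I)
    fix h assume h: "h \<in> heads kf kb"
    obtain s d i where h_eq: "h = (s, d, i)" by (cases h) auto
    have "snd c h \<in> pos_range n d" using configs_pos[OF c] h h_eq by simp
    then show "snd (step kf kb M S T c) h \<in> pos_range n (fst (snd h))"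
      using h h_eq next_pos_in_range length_stream_of[OF len, of s] by (auto simp: snd_step)
  qed (auto simp: snd_step)
  ultimately show ?thesis by (metis configs_def mem_Times_iff)
qed

lemma config_at_in_configs:
  assumes "mp2s_automaton D m kf kb M"
    and "S \<in> lists D" "T \<in> lists D" and len: "length S = n" "length T = n"
  shows "config_at kf kb M S T t \<in> configs n (states M) kf kb"
proof (induction t)
  case 0
  have "init_pos d (stream_of S T s) \<in> pos_range n d" for s d
    using length_stream_of[OF len, of s] by (cases d) auto
  then show ?case using assms(1)
    by (auto simp: config_at_def init_config_def configs_def mp2s_automaton_def PiE_iff)
next
  case (Suc t)
  then show ?case using step_in_configs[OF assms] by (simp add: config_at_Suc)
qed

lemma behind_step:
  "(s, d, i) \<in> heads kf kb \<Longrightarrow> behind d (snd c (s, d, i)) (snd (step kf kb M S T c) (s, d, i))"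
  by (simp add: snd_step behind_next_pos)

lemma behind_config_at:
  assumes "(s, d, i) \<in> heads kf kb" and "t \<le> u"
  shows "behind d (snd (config_at kf kb M S T t) (s, d, i)) (snd (config_at kf kb M S T u) (s, d, i))"
  using assms(2)
proof (induction rule: dec_induct)
  case base
  show ?case by (cases d) auto
next
  case (step u)
  show ?case unfolding config_at_Suc
    by (rule behind_trans[OF step.IH behind_step[OF assms(1)]])
qed

text \<open>A step depends on the input only through the stream lengths and the symbols under the
  heads that have not passed their stream.\<close>

lemma step_cong:
  assumes len: "length S = n" "length T = n" "length S' = n" "length T' = n"
    and c: "c \<in> configs n Q kf kb"
    and agree: "\<And>s d i. (s, d, i) \<in> heads kf kb \<Longrightarrow> snd c (s, d, i) \<in> {1..n} \<Longrightarrow>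
      stream_of S T s ! (snd c (s, d, i) - 1) = stream_of S' T' s ! (snd c (s, d, i) - 1)"
  shows "step kf kb M S T c = step kf kb M S' T' c"
proof -
  have lens: "length (stream_of S T s) = length (stream_of S' T' s)" "length (stream_of S T s) = n"
    for s using len length_stream_of by metis+
  have "symbol_at d (stream_of S T s) (snd c (s, d, i)) = symbol_at d (stream_of S' T' s) (snd c (s, d, i))"
    if h: "(s, d, i) \<in> heads kf kb" for s d i
  proof -
    have "snd c (s, d, i) \<in> pos_range (length (stream_of S T s)) d"
      using configs_pos[OF c h] lens by simp
    then show ?thesis
      using agree[OF h] not_passed_range passed_cong[OF lens(1)] lens(2)
      unfolding symbol_at_def by metis
  qed
  then have "read_symbols kf kb S T (snd c) = read_symbols kf kb S' T' (snd c)"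
    by (auto simp: read_symbols_def fun_eq_iff restrict_def)
  then show ?thesis
    using next_pos_cong[OF lens(1)] by (intro prod_eqI) (simp_all add: fst_step snd_step)
qed

lemma final_config_cong:
  assumes "length S = n" "length T = n" "length S' = n" "length T' = n"
  shows "final_config kf kb S T c = final_config kf kb S' T' c"
proof -
  have "length (stream_of S T s) = length (stream_of S' T' s)" for s
    using assms length_stream_of by metis
  from passed_cong[OF this] show ?thesis by (simp add: final_config_def)
qed

text \<open>It never increases along a run and drops whenever a head changes its position, so it
  bounds the number of changes between runs.\<close>

definition potential :: "nat \<Rightarrow> nat \<Rightarrow> nat \<Rightarrow> 'q config \<Rightarrow> nat" where
  "potential n kf kb c = (\<Sum>h\<in>heads kf kb. distance_left n (fst (snd h)) (snd c h))"

lemma potential_step: "potential n kf kb (step kf kb M S T c) \<le> potential n kf kb c"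
  unfolding potential_def by (intro sum_mono) (auto intro!: distance_left_mono behind_step simp: split_paired_all)

lemma potential_step_strict:
  assumes c: "step kf kb M S T c \<in> configs n Q kf kb" and h: "h \<in> heads kf kb"
    and moved: "snd (step kf kb M S T c) h \<noteq> snd c h"
  shows "potential n kf kb (step kf kb M S T c) < potential n kf kb c"
  unfolding potential_def
proof (rule sum_strict_mono_ex1)
  show "\<forall>h\<in>heads kf kb. distance_left n (fst (snd h)) (snd (step kf kb M S T c) h)
      \<le> distance_left n (fst (snd h)) (snd c h)"
    by (auto intro!: distance_left_mono behind_step simp: split_paired_all)
  obtain s d i where h_eq: "h = (s, d, i)" by (cases h) auto
  have "snd (step kf kb M S T c) h \<in> pos_range n d" using configs_pos[OF c] h h_eq by simp
  then have "distance_left n d (snd (step kf kb M S T c) h) < distance_left n d (snd c h)"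
    using h h_eq moved by (intro distance_left_strict_mono) (auto intro: behind_step)
  then show "\<exists>h\<in>heads kf kb. distance_left n (fst (snd h)) (snd (step kf kb M S T c) h)
      < distance_left n (fst (snd h)) (snd c h)"
    using h h_eq by force
qed simp

section \<open>Fooling an automaton that never checks a block\<close>

text \<open>The final configuration serves as a default for heads that never enter their block.\<close>

definition entry_config ::
  "(stream \<Rightarrow> nat set) \<Rightarrow> nat \<Rightarrow> nat \<Rightarrow> ('q, 'd) mp2s \<Rightarrow> 'd list \<Rightarrow> 'd list \<Rightarrow> head \<Rightarrow> 'q config"
  where "entry_config B kf kb M S T h = config_at kf kb M S T
     (LEAST t. snd (config_at kf kb M S T t) h \<in> B (fst h) \<or>
               final_config kf kb S T (config_at kf kb M S T t))"

text \<open>All moments are quantified, also those after the end of the computation, so the notion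
  does not depend on whether the computation ends.\<close>

definition never_checks ::
  "(stream \<Rightarrow> nat set) \<Rightarrow> nat \<Rightarrow> nat \<Rightarrow> ('q, 'd) mp2s \<Rightarrow> 'd list \<Rightarrow> 'd list \<Rightarrow> bool"
  where "never_checks B kf kb M S T \<longleftrightarrow>
    (\<forall>t. \<forall>h\<in>heads kf kb. \<forall>h'\<in>heads kf kb. fst h = Stream_S \<longrightarrow> fst h' = Stream_T \<longrightarrow>
      \<not> (snd (config_at kf kb M S T t) h \<in> B Stream_S \<and>
         snd (config_at kf kb M S T t) h' \<in> B Stream_T))"

text \<open>A head never turns back and its block is an interval, so it enters the block at most
  once: an observed entry is the one that \<open>LEAST\<close> finds, provided that no earlier
  configuration is final.\<close>

lemma entry_config_Suc:
  assumes h: "h \<in> heads kf kb"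
    and convex: "\<And>a b c. a \<in> B (fst h) \<Longrightarrow> c \<in> B (fst h) \<Longrightarrow> a \<le> b \<Longrightarrow> b \<le> c \<Longrightarrow> b \<in> B (fst h)"
    and not_final: "\<And>u. u \<le> t \<Longrightarrow> \<not> final_config kf kb S T (config_at kf kb M S T u)"
    and out: "snd (config_at kf kb M S T t) h \<notin> B (fst h)"
    and inside: "snd (config_at kf kb M S T (Suc t)) h \<in> B (fst h)"
  shows "entry_config B kf kb M S T h = config_at kf kb M S T (Suc t)"
proof -
  let ?c = "config_at kf kb M S T"
  obtain s d i where h_eq: "h = (s, d, i)" by (cases h) auto
  have "snd (?c u) h \<notin> B (fst h)" if "u \<le> t" for u
  proof
    assume u: "snd (?c u) h \<in> B (fst h)"
    have "behind d (snd (?c u) h) (snd (?c t) h)" "behind d (snd (?c t) h) (snd (?c (Suc t)) h)"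
      unfolding h_eq by (rule behind_config_at; use h h_eq that in simp)+
    then show False using out convex[OF u inside] convex[OF inside u] by (cases d) simp_all
  qed
  then have "(LEAST t. snd (?c t) h \<in> B (fst h) \<or> final_config kf kb S T (?c t)) = Suc t"
    using inside not_final by (intro Least_equality) (auto simp: not_less_eq_eq[symmetric])
  then show ?thesis by (simp add: entry_config_def)
qed

text \<open>Runs are indexed by streams, and the crossed input takes stream \<open>s\<close> from
  the input of run \<open>s\<close>. So only heads on the other stream can notice that the input
  differs from that of run \<open>x\<close>, and only inside the block.\<close>

lemma accepts_crossed_input:
  fixes S T :: "stream \<Rightarrow> 'd list" and M :: "('q, 'd) mp2s"
  assumes M: "mp2s_automaton D m kf kb M"
    and lists: "\<And>x. S x \<in> lists D" "\<And>x. T x \<in> lists D"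
    and len: "\<And>x. length (S x) = n" "\<And>x. length (T x) = n"
    and convex: "\<And>s a b c. a \<in> B s \<Longrightarrow> c \<in> B s \<Longrightarrow> a \<le> b \<Longrightarrow> b \<le> c \<Longrightarrow> b \<in> B s"
    and agree: "\<And>x s a. a \<in> {1..n} - B s \<Longrightarrow>
      stream_of (S x) (T x) s ! (a - 1) = stream_of (S s) (T s) s ! (a - 1)"
    and accepts: "\<And>x. accepts kf kb M (S x) (T x)"
    and no_check: "\<And>x. never_checks B kf kb M (S x) (T x)"
    and entries: "\<And>h x y. h \<in> heads kf kb \<Longrightarrow>
      entry_config B kf kb M (S x) (T x) h = entry_config B kf kb M (S y) (T y) h"
  shows "accepts kf kb M (S Stream_S) (T Stream_T)"
proof -
  define \<rho> where "\<rho> x t = config_at kf kb M (S x) (T x) t" for x t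
  define g where "g = step kf kb M (S Stream_S) (T Stream_T)"
  define final :: "'q config \<Rightarrow> bool" where "final = final_config kf kb (S Stream_S) (T Stream_T)"
  \<comment> \<open>Under \<open>ok x\<close> every head inside its block is on stream
    \<open>x\<close>, where the crossed input and input \<open>x\<close> coincide; outside the
    blocks all inputs agree.\<close>
  define ok :: "stream \<Rightarrow> 'q config \<Rightarrow> bool"
    where "ok x c \<longleftrightarrow> (\<forall>h\<in>heads kf kb. fst h \<noteq> x \<longrightarrow> snd c h \<notin> B (fst h))" for x c
  have final: "final_config kf kb (S x) (T x) = final" for x
    unfolding final_def by (rule ext, rule final_config_cong) (use len in auto)
  have "\<forall>x. \<exists>t. final (\<rho> x t) \<and> (\<forall>u<t. \<not> final (\<rho> x u)) \<and> fst (\<rho> x t) \<in> accepting M"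
    using accepts unfolding accepts_def final \<rho>_def by blast
  then obtain tf where tf: "\<And>x. final (\<rho> x (tf x))" "\<And>x u. u < tf x \<Longrightarrow> \<not> final (\<rho> x u)"
    "\<And>x. fst (\<rho> x (tf x)) \<in> accepting M" by metis
  have in_configs: "\<rho> x t \<in> configs n (states M) kf kb" for x t
    unfolding \<rho>_def by (rule config_at_in_configs[OF M lists len])
  have Suc: "\<rho> x (Suc t) = step kf kb M (S x) (T x) (\<rho> x t)" for x t
    by (simp add: \<rho>_def config_at_Suc)
  \<comment> \<open>A head in the block of one stream excludes heads in the block of the other,
    because the block is never checked. Hence in each configuration of a run at least one of the two
    runs can be followed.\<close>
  have ok_other: "ok s (\<rho> x t)" if bad: "\<not> ok x (\<rho> x t)" and "s \<noteq> x" for s x t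
  proof -
    obtain h where h: "h \<in> heads kf kb" "fst h \<noteq> x" "snd (\<rho> x t) h \<in> B (fst h)"
      using bad unfolding ok_def by blast
    have two: "a = b" if "a \<noteq> x" "b \<noteq> x" for a b
      using that by (cases a; cases b; cases x) auto
    have "snd (\<rho> x t) h' \<notin> B (fst h')" if "h' \<in> heads kf kb" "fst h' = x" for h'
      using no_check[of x] h that unfolding never_checks_def \<rho>_def[symmetric]
      by (cases "fst h"; cases x) auto
    then show ?thesis unfolding ok_def using two \<open>s \<noteq> x\<close> by blast
  qed
  have ok_some: "\<exists>x. ok x (\<rho> Stream_S 0)"
    using ok_other by (metis stream.distinct(1))
  \<comment> \<open>The initial configuration depends only on the lengths, so the simulation may
    begin with whichever run is \<open>ok\<close>.\<close>
  have start: "\<rho> x 0 = init_config kf kb M (S Stream_S) (T Stream_T)" for x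
  proof -
    have "length (stream_of (S x) (T x) s) = length (stream_of (S Stream_S) (T Stream_T) s)" for s
      using len length_stream_of by metis
    then have "init_pos d (stream_of (S x) (T x) s) = init_pos d (stream_of (S Stream_S) (T Stream_T) s)"
      for s d by (cases d) simp_all
    then show ?thesis by (simp add: \<rho>_def config_at_def init_config_def)
  qed
  then obtain x where x: "ok x (\<rho> x 0)" using ok_some by metis
  have "\<exists>u. final ((g ^^ u) (\<rho> x 0)) \<and> fst ((g ^^ u) (\<rho> x 0)) \<in> accepting M \<and>
             (\<forall>j<u. \<not> final ((g ^^ j) (\<rho> x 0)))"
  proof (rule alternating_simulation[where tf = tf and ok = ok and \<Phi> = "potential n kf kb"])
    fix x t assume "t < tf x" and ok: "ok x (\<rho> x t)"
    have own: "stream_of (S Stream_S) (T Stream_T) s = stream_of (S s) (T s) s" for s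
      by (cases s) auto
    show "g (\<rho> x t) = \<rho> x (Suc t)"
      unfolding g_def Suc
    proof (rule step_cong[OF _ _ _ _ in_configs])
      fix s d i assume h: "(s, d, i) \<in> heads kf kb" and r: "snd (\<rho> x t) (s, d, i) \<in> {1..n}"
      show "stream_of (S Stream_S) (T Stream_T) s ! (snd (\<rho> x t) (s, d, i) - 1) =
            stream_of (S x) (T x) s ! (snd (\<rho> x t) (s, d, i) - 1)"
      proof (cases "s = x")
        case False
        then have "snd (\<rho> x t) (s, d, i) \<notin> B s" using ok h by (auto simp: ok_def)
        then show ?thesis
          unfolding own using r by (intro agree[of "snd (\<rho> x t) (s, d, i)" s x, symmetric] DiffI)
      next
        case True
        show ?thesis unfolding own unfolding True ..
      qed
    qed (use len in auto)
  next
    fix x t assume t: "t < tf x" and ok: "ok x (\<rho> x t)" and not_ok: "\<not> ok x (\<rho> x (Suc t))"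
    obtain h where h: "h \<in> heads kf kb" "fst h \<noteq> x" "snd (\<rho> x (Suc t)) h \<in> B (fst h)"
      using not_ok unfolding ok_def by blast
    have out: "snd (\<rho> x t) h \<notin> B (fst h)" using ok h by (auto simp: ok_def)
    let ?y = "fst h"
    \<comment> \<open>The head \<open>h\<close> that violates \<open>ok x\<close> has just entered
      its block, so the configuration reached is an entry configuration, and the other run passes
      through it too.\<close>
    have "entry_config B kf kb M (S x) (T x) h = \<rho> x (Suc t)"
      unfolding \<rho>_def
    proof (rule entry_config_Suc[OF h(1) convex])
      show "\<not> final_config kf kb (S x) (T x) (config_at kf kb M (S x) (T x) u)" if "u \<le> t" for u
        using tf(2)[of u x] t that unfolding final \<rho>_def by simp
    qed (use h out in \<open>simp_all add: \<rho>_def\<close>)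
    \<comment> \<open>The disjunct for final configurations keeps the least moment within
      \<open>tf ?y\<close>.\<close>
    moreover have "\<exists>t'\<le>tf ?y. entry_config B kf kb M (S ?y) (T ?y) h = \<rho> ?y t'"
    proof (intro exI conjI)
      show "entry_config B kf kb M (S ?y) (T ?y) h =
          \<rho> ?y (LEAST t. snd (\<rho> ?y t) h \<in> B ?y \<or> final (\<rho> ?y t))"
        unfolding entry_config_def final \<rho>_def ..
      show "(LEAST t. snd (\<rho> ?y t) h \<in> B ?y \<or> final (\<rho> ?y t)) \<le> tf ?y"
        using tf(1) by (intro Least_le disjI2)
    qed
    ultimately have "\<exists>t'\<le>tf ?y. \<rho> x (Suc t) = \<rho> ?y t'"
      unfolding entries[OF h(1), of x ?y] by simp
    moreover have "ok ?y (\<rho> x (Suc t))" using ok_other not_ok h by blast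
    moreover have "potential n kf kb (\<rho> x (Suc t)) < potential n kf kb (\<rho> x t)"
      using out h in_configs[of x "Suc t"] unfolding Suc by (intro potential_step_strict) auto
    ultimately show "potential n kf kb (\<rho> x (Suc t)) < potential n kf kb (\<rho> x t) \<and>
      (\<exists>y t'. t' \<le> tf y \<and> \<rho> x (Suc t) = \<rho> y t' \<and> ok y (\<rho> x (Suc t)))"
      by blast
  qed (use tf x in \<open>auto simp: Suc potential_step\<close>)
  then show ?thesis
    unfolding accepts_def config_at_def start g_def final_def by blast
qed


section \<open>A block arrangement that leaves some block unchecked\<close>

text \<open>Blocks are numbered from 0 but positions from 1, hence the open left end; position 0
  lies in no block.\<close>

definition block :: "nat \<Rightarrow> nat \<Rightarrow> nat set" where
  "block l w = {w * l<..Suc w * l}"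

text \<open>The \<open>p * q\<close> blocks form \<open>p\<close> consecutive rows of \<open>q\<close> blocks each. The order of the rows is
  reversed, the order inside each row is kept.\<close>

definition reverse_rows :: "nat \<Rightarrow> nat \<Rightarrow> nat \<Rightarrow> nat" where
  "reverse_rows p q w = (p - 1 - w div q) * q + w mod q"

text \<open>The number \<open>w\<close> refers to \<open>S\<close>; the complementary items stand in
  block \<open>reverse_rows p q w\<close> of \<open>T\<close>.\<close>

fun block_on :: "nat \<Rightarrow> nat \<Rightarrow> nat \<Rightarrow> nat \<Rightarrow> stream \<Rightarrow> nat set" where
  "block_on l p q w Stream_S = block l w"
| "block_on l p q w Stream_T = block l (reverse_rows p q w)"

lemma block_index_mono:
  assumes "a \<in> block l w" "b \<in> block l w'" "a \<le> b"
  shows "w \<le> w'"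
proof (rule ccontr)
  assume "\<not> w \<le> w'"
  then have "Suc w' * l \<le> w * l" by (intro mult_le_mono1) simp
  then show False using assms by (auto simp: block_def)
qed

lemma Suc_in_block_iff:
  assumes "l > 0"
  shows "Suc j \<in> block l w \<longleftrightarrow> j div l = w"
proof
  assume "Suc j \<in> block l w"
  then show "j div l = w" by (intro div_nat_eqI) (auto simp: block_def mult.commute)
next
  assume "j div l = w"
  then show "Suc j \<in> block l w"
    using assms dividend_less_div_times[of l j] by (auto simp: block_def less_Suc_eq_le)
qed

lemma reverse_rows_less:
  assumes "w < p * q"
  shows "reverse_rows p q w < p * q"
proof -
  have q: "q > 0" and w: "w div q < p" using assms by (auto intro: Nat.gr0I less_mult_imp_div_less)
  have "reverse_rows p q w < Suc (p - 1 - w div q) * q" using q by (simp add: reverse_rows_def)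
  also have "\<dots> \<le> p * q" using w by (intro mult_le_mono1) simp
  finally show ?thesis .
qed

lemma reverse_rows_div: "q > 0 \<Longrightarrow> reverse_rows p q w div q = p - 1 - w div q"
  by (simp add: reverse_rows_def)

lemma reverse_rows_mod: "reverse_rows p q w mod q = w mod q"
  by (simp add: reverse_rows_def)

lemma reverse_rows_involution:
  assumes "w < p * q"
  shows "reverse_rows p q (reverse_rows p q w) = w"
proof -
  have q: "q > 0" and w: "w div q < p" using assms by (auto intro: Nat.gr0I less_mult_imp_div_less)
  then have "p - 1 - (p - 1 - w div q) = w div q" by simp
  then show ?thesis
    unfolding reverse_rows_def[of p q "reverse_rows p q w"]
    using q by (simp add: reverse_rows_div reverse_rows_mod)
qed

text \<open>Blocks of different rows change their order. This confines a pair of heads moving in the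
  same direction to one row.\<close>

lemma reverse_rows_same_order:
  assumes "w < p * q" "w' < p * q" "w \<le> w'" "reverse_rows p q w \<le> reverse_rows p q w'"
  shows "w div q = w' div q"
proof -
  have q: "q > 0" and "w div q < p" "w' div q < p"
    using assms by (auto intro: Nat.gr0I less_mult_imp_div_less)
  moreover have "w div q \<le> w' div q" using assms(3) by (rule div_le_mono)
  moreover have "p - 1 - w div q \<le> p - 1 - w' div q"
    using div_le_mono[OF assms(4), of q] q by (simp add: reverse_rows_div)
  ultimately show ?thesis by linarith
qed

text \<open>Inside a row the order is kept. This confines a pair of heads moving in opposite
  directions to one block per row.\<close>

lemma reverse_rows_opposite_order:
  assumes "w div q = w' div q" "w \<le> w'" "reverse_rows p q w' \<le> reverse_rows p q w"
  shows "w = w'"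
proof -
  have "w' mod q \<le> w mod q" using assms(1,3) by (simp add: reverse_rows_def)
  then show ?thesis using assms(1,2) by (metis div_mult_mod_eq le_antisym nat_add_left_cancel_le)
qed

text \<open>Otherwise choosing a related \<open>x\<close> for each \<open>a\<close> would be an
  injection of \<open>A\<close> into the smaller set \<open>P\<close>.\<close>

lemma exists_unrelated:
  assumes "finite P" "card P < card A"
    and unique: "\<And>x a b. x \<in> P \<Longrightarrow> a \<in> A \<Longrightarrow> b \<in> A \<Longrightarrow> R x a \<Longrightarrow> R x b \<Longrightarrow> a = b"
  shows "\<exists>a\<in>A. \<forall>x\<in>P. \<not> R x a"
proof (rule ccontr)
  assume "\<not> ?thesis"
  then obtain g where g: "\<And>a. a \<in> A \<Longrightarrow> g a \<in> P \<and> R (g a) a" by metis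
  then have "inj_on g A" using unique by (intro inj_onI) metis
  moreover have "g ` A \<subseteq> P" using g by blast
  ultimately have "card A \<le> card P" using assms(1) by (metis card_inj_on_le)
  then show False using assms(2) by simp
qed

text \<open>The choice of a row is followed by that of a block in it. There are
  \<open>kf^2 + kb^2\<close> pairs moving in the same direction and \<open>2 * kf * kb\<close>
  moving in opposite directions; \<open>p\<close> and \<open>q\<close> exceed these numbers by
  one.\<close>

lemma exists_unchecked_block:
  fixes M :: "('q, 'd) mp2s"
  assumes p: "p = kf^2 + kb^2 + 1" and q: "q = 2 * kf * kb + 1"
  shows "\<exists>w<p * q. never_checks (block_on l p q w) kf kb M S T"
proof -
  define pos where "pos s h t = snd (config_at kf kb M S T t) (s, h)" for s h t
  define F where "F = {Forward} \<times> {..<kf}"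
  define G where "G = {Backward} \<times> {..<kb}"
  \<comment> \<open>Here \<open>x\<close> pairs a head on \<open>S\<close> with a head on
    \<open>T\<close>, each given by direction and number only.\<close>
  define chk where "chk x w \<longleftrightarrow> (\<exists>t. pos Stream_S (fst x) t \<in> block l w \<and>
      pos Stream_T (snd x) t \<in> block l (reverse_rows p q w))" for x w
  have heads: "(s, h) \<in> heads kf kb \<longleftrightarrow> h \<in> F \<union> G" for s h
    by (auto simp: heads_def F_def G_def)
  have mono: "behind (fst h) (pos s h t) (pos s h u)" if "h \<in> F \<union> G" "t \<le> u" for s h t u
    using behind_config_at[of s "fst h" "snd h" kf kb t u] that heads unfolding pos_def by simp
  \<comment> \<open>Whichever of the two checks comes first, both heads move the same way from it to
    the other; in \<open>order_opposite\<close> they move in contrary ways.\<close>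
  have order_same: "w \<le> w' \<and> reverse_rows p q w \<le> reverse_rows p q w' \<or>
      w' \<le> w \<and> reverse_rows p q w' \<le> reverse_rows p q w"
    if x: "x \<in> F \<times> F \<union> G \<times> G" and checked: "chk x w" "chk x w'" for x w w'
  proof -
    obtain t t' where t: "pos Stream_S (fst x) t \<in> block l w"
        "pos Stream_T (snd x) t \<in> block l (reverse_rows p q w)"
        "pos Stream_S (fst x) t' \<in> block l w'"
        "pos Stream_T (snd x) t' \<in> block l (reverse_rows p q w')"
      using checked unfolding chk_def by blast
    have "pos Stream_S (fst x) t \<le> pos Stream_S (fst x) t' \<and> pos Stream_T (snd x) t \<le> pos Stream_T (snd x) t' \<or>
        pos Stream_S (fst x) t' \<le> pos Stream_S (fst x) t \<and> pos Stream_T (snd x) t' \<le> pos Stream_T (snd x) t"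
      using x mono[of "fst x" t t' Stream_S] mono[of "snd x" t t' Stream_T]
        mono[of "fst x" t' t Stream_S] mono[of "snd x" t' t Stream_T]
      by (cases "t \<le> t'") (auto simp: F_def G_def)
    then show ?thesis using t block_index_mono by blast
  qed
  have order_opposite: "w \<le> w' \<and> reverse_rows p q w' \<le> reverse_rows p q w \<or>
      w' \<le> w \<and> reverse_rows p q w \<le> reverse_rows p q w'"
    if x: "x \<in> F \<times> G \<union> G \<times> F" and checked: "chk x w" "chk x w'" for x w w'
  proof -
    obtain t t' where t: "pos Stream_S (fst x) t \<in> block l w"
        "pos Stream_T (snd x) t \<in> block l (reverse_rows p q w)"
        "pos Stream_S (fst x) t' \<in> block l w'"
        "pos Stream_T (snd x) t' \<in> block l (reverse_rows p q w')"
      using checked unfolding chk_def by blast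
    have "pos Stream_S (fst x) t \<le> pos Stream_S (fst x) t' \<and> pos Stream_T (snd x) t' \<le> pos Stream_T (snd x) t \<or>
        pos Stream_S (fst x) t' \<le> pos Stream_S (fst x) t \<and> pos Stream_T (snd x) t \<le> pos Stream_T (snd x) t'"
      using x mono[of "fst x" t t' Stream_S] mono[of "snd x" t t' Stream_T]
        mono[of "fst x" t' t Stream_S] mono[of "snd x" t' t Stream_T]
      by (cases "t \<le> t'") (auto simp: F_def G_def)
    then show ?thesis using t block_index_mono by blast
  qed
  have fin: "finite F" "finite G" and cards: "card F = kf" "card G = kb"
    by (simp_all add: F_def G_def card_cartesian_product)
  have "card (F \<times> F \<union> G \<times> G) \<le> kf^2 + kb^2"
    using card_Un_le[of "F \<times> F" "G \<times> G"]
    by (simp add: card_cartesian_product cards power2_eq_square)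
  \<comment> \<open>A pair is related to a row if it checks some block of that row.\<close>
  then have "\<exists>r\<in>{..<p}. \<forall>x\<in>F \<times> F \<union> G \<times> G. \<not> (\<exists>w<p * q. w div q = r \<and> chk x w)"
    using fin p order_same reverse_rows_same_order
    by (intro exists_unrelated) (fastforce, fastforce, metis)
  then obtain r where r: "r < p" "\<And>x w. x \<in> F \<times> F \<union> G \<times> G \<Longrightarrow> w < p * q \<Longrightarrow> w div q = r \<Longrightarrow> \<not> chk x w"
    by blast
  have row: "(r * q + y) div q = r" if "y < q" for y using that by simp
  have "card (F \<times> G \<union> G \<times> F) \<le> 2 * kf * kb"
    using card_Un_le[of "F \<times> G" "G \<times> F"] by (simp add: card_cartesian_product cards mult.commute)
  then have "\<exists>y\<in>{..<q}. \<forall>x\<in>F \<times> G \<union> G \<times> F. \<not> chk x (r * q + y)"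
  proof (intro exists_unrelated)
    fix x y z assume "x \<in> F \<times> G \<union> G \<times> F" "y \<in> {..<q}" "z \<in> {..<q}"
      "chk x (r * q + y)" "chk x (r * q + z)"
    then have "r * q + y = r * q + z"
      using order_opposite[of x "r * q + y" "r * q + z"] row[of y] row[of z]
        reverse_rows_opposite_order[of "r * q + y" q "r * q + z" p]
        reverse_rows_opposite_order[of "r * q + z" q "r * q + y" p]
      by (metis lessThan_iff)
    then show "y = z" by simp
  qed (use fin q in auto)
  then obtain y where y: "y < q" "\<And>x. x \<in> F \<times> G \<union> G \<times> F \<Longrightarrow> \<not> chk x (r * q + y)" by blast
  let ?w = "r * q + y"
  have "?w < Suc r * q" using y by simp
  also have "\<dots> \<le> p * q" using r by (intro mult_le_mono1) simp
  finally have w: "?w < p * q" .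
  have "\<not> chk (h, h') ?w" if "h \<in> F \<union> G" "h' \<in> F \<union> G" for h h'
    using r(2)[OF _ w row[OF y(1)]] y(2) that by blast
  then have "never_checks (block_on l p q ?w) kf kb M S T"
    unfolding never_checks_def by (fastforce simp: heads chk_def pos_def)
  then show ?thesis using w by blast
qed

section \<open>The fooling inputs\<close>

text \<open>List indices start at \<open>0\<close>: index \<open>i\<close> is head position \<open>Suc i\<close>, and it stands for the pair of items
  numbered \<open>Suc i\<close>.\<close>

definition fool_S :: "nat \<Rightarrow> nat set \<Rightarrow> item list" where
  "fool_S n I = map (\<lambda>i. if i \<in> I then Item_a (Suc i) else Item_b (Suc i)) [0..<n]"

text \<open>Sends an index of \<open>T\<close> to the index of its item pair on \<open>S\<close>:
  blocks are rearranged, offsets inside a block are kept, and the remainder after the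
  \<open>p * q\<close> blocks is fixed.\<close>

definition fool_perm :: "nat \<Rightarrow> nat \<Rightarrow> nat \<Rightarrow> nat \<Rightarrow> nat" where
  "fool_perm l p q j =
     (if j div l < p * q then reverse_rows p q (j div l) * l + j mod l else j)"

text \<open>From each pair \<open>T\<close> takes the item that \<open>S\<close> leaves out.\<close>

definition fool_T :: "nat \<Rightarrow> nat \<Rightarrow> nat \<Rightarrow> nat \<Rightarrow> nat set \<Rightarrow> item list" where
  "fool_T n l p q I = map (\<lambda>j. if fool_perm l p q j \<in> I then Item_b (Suc (fool_perm l p q j))
                               else Item_a (Suc (fool_perm l p q j))) [0..<n]"

lemma fool_perm_less:
  assumes "l > 0" "p * q * l \<le> n" "j < n"
  shows "fool_perm l p q j < n"
proof (cases "j div l < p * q")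
  case True
  then have "fool_perm l p q j < Suc (reverse_rows p q (j div l)) * l"
    using assms(1) by (simp add: fool_perm_def)
  also have "\<dots> \<le> p * q * l"
    using reverse_rows_less[OF True] by (intro mult_le_mono1) simp
  finally show ?thesis using assms(2) by simp
qed (use assms in \<open>simp add: fool_perm_def\<close>)

lemma fool_perm_div:
  assumes "l > 0" "fool_perm l p q j div l = w" "w < p * q"
  shows "j div l = reverse_rows p q w"
  using assms reverse_rows_involution
  by (cases "j div l < p * q") (auto simp: fool_perm_def)

lemma fool_perm_surj:
  assumes "l > 0" "i div l < p * q"
  shows "\<exists>j<p * q * l. fool_perm l p q j = i"
proof (intro exI conjI)
  \<comment> \<open>Since \<open>reverse_rows\<close> is its own inverse, rearranging the block of
    \<open>i\<close> gives a preimage.\<close>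
  let ?w = "reverse_rows p q (i div l)"
  have w: "?w < p * q" using assms(2) by (rule reverse_rows_less)
  have "?w * l + i mod l < Suc ?w * l" using assms(1) by simp
  also have "\<dots> \<le> p * q * l" using w by (intro mult_le_mono1) simp
  finally show "?w * l + i mod l < p * q * l" .
  show "fool_perm l p q (?w * l + i mod l) = i"
    using w assms by (simp add: fool_perm_def reverse_rows_involution)
qed

lemma length_fool [simp]: "length (fool_S n I) = n" "length (fool_T n l p q I) = n"
  by (simp_all add: fool_S_def fool_T_def)

lemma fool_S_in_lists: "fool_S n I \<in> lists (disj_items n)"
  by (auto simp: fool_S_def disj_items_def)

lemma fool_T_in_lists:
  assumes "l > 0" "p * q * l \<le> n"
  shows "fool_T n l p q I \<in> lists (disj_items n)"
proof -
  have "Suc (fool_perm l p q j) \<in> {1..n}" if "j < n" for j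
    using fool_perm_less[OF assms that] by simp
  then show ?thesis by (auto simp: fool_T_def disj_items_def)
qed

lemma fool_disjoint: "set (fool_S n I) \<inter> set (fool_T n l p q I) = {}"
  by (auto simp: fool_S_def fool_T_def split: if_splits)

text \<open>From pair \<open>Suc i\<close> the first stream takes the \<open>a\<close>-item because
  of \<open>I\<close>, and the second takes it too because \<open>I'\<close> lacks
  \<open>i\<close>.\<close>

lemma fool_crossed_not_disjoint:
  assumes "l > 0" "p * q * l \<le> n" "i div l < p * q" "i < n" "i \<in> I" "i \<notin> I'"
  shows "set (fool_S n I) \<inter> set (fool_T n l p q I') \<noteq> {}"
proof -
  obtain j where "j < p * q * l" and j: "fool_perm l p q j = i"
    using fool_perm_surj[OF assms(1,3)] by blast
  then have "j < n" using assms(2) by simp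
  have "Item_a (Suc i) \<in> set (fool_S n I)"
    unfolding fool_S_def using assms by (force simp: image_iff)
  moreover have "Item_a (Suc i) \<in> set (fool_T n l p q I')"
    unfolding fool_T_def using assms j \<open>j < n\<close> by (force simp: image_iff)
  ultimately show ?thesis by blast
qed

lemma fool_agree:
  assumes "l > 0" "w < p * q" and agree: "\<And>i. i div l \<noteq> w \<Longrightarrow> i \<in> I \<longleftrightarrow> i \<in> I'"
    and a: "a \<in> {1..n} - block_on l p q w s"
  shows "stream_of (fool_S n I) (fool_T n l p q I) s ! (a - 1) =
         stream_of (fool_S n I') (fool_T n l p q I') s ! (a - 1)"
proof -
  obtain j where j: "a = Suc j" "j < n" using a by (cases a) auto
  show ?thesis
  proof (cases s)
    case Stream_S
    then have "j div l \<noteq> w" using a j Suc_in_block_iff[OF assms(1)] by auto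
    then show ?thesis using j Stream_S agree by (simp add: fool_S_def)
  next
    case Stream_T
    then have "j div l \<noteq> reverse_rows p q w" using a j Suc_in_block_iff[OF assms(1)] by auto
    then have "fool_perm l p q j div l \<noteq> w" using fool_perm_div assms(1,2) by blast
    then show ?thesis using j Stream_T agree by (simp add: fool_T_def)
  qed
qed

section \<open>Counting the records and the numerical bound\<close>

text \<open>If the bound failed, there would be fewer records than the \<open>2 ^ n\<close> subsets
  of \<open>{..<n}\<close>, and two inputs with equal records could be crossed.\<close>

lemma solves_disj_record_bound:
  fixes M :: "('q, item) mp2s"
  assumes M: "mp2s_automaton (disj_items n) m kf kb M" and solves: "solves_disj n kf kb M"
    and p: "p = kf^2 + kb^2 + 1" and q: "q = 2 * kf * kb + 1"
    and l: "l > 0" "p * q * l \<le> n" and k: "k = 2 * kf + 2 * kb"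
  shows "2 ^ l \<le> p * q * (m * (n + 1) ^ k) ^ k"
proof (rule ccontr)
  assume "\<not> ?thesis"
  then have small: "p * q * (m * (n + 1) ^ k) ^ k < 2 ^ l" by simp
  define S where "S I = fool_S n I" for I
  define T where "T I = fool_T n l p q I" for I
  define J where "J w = {i. i div l = w}" for w
  let ?H = "heads kf kb" and ?C = "configs n (states M) kf kb"
  have in_lists: "S I \<in> lists (disj_items n)" "T I \<in> lists (disj_items n)" for I
    unfolding S_def T_def using fool_S_in_lists fool_T_in_lists[OF l] by auto
  have len: "length (S I) = n" "length (T I) = n" for I by (simp_all add: S_def T_def)
  have correct: "accepts kf kb M (S I) (T I') \<longleftrightarrow> set (S I) \<inter> set (T I') = {}" for I I'
    using solves in_lists len unfolding solves_disj_def by blast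
  have "\<forall>I. \<exists>w<p * q. never_checks (block_on l p q w) kf kb M (S I) (T I)"
    by (intro allI exists_unchecked_block[OF p q])
  then obtain W where W: "\<And>I. W I < p * q" "\<And>I. never_checks (block_on l p q (W I)) kf kb M (S I) (T I)"
    by metis
  \<comment> \<open>The record of \<open>I\<close>: an unchecked block, the part of \<open>I\<close>
    outside it, and the entry configuration of each head.\<close>
  define f where "f I = (W I, I - J (W I),
      \<lambda>h\<in>?H. entry_config (block_on l p q (W I)) kf kb M (S I) (T I) h)" for I
  \<comment> \<open>For each of the \<open>p * q\<close> blocks this allows
    \<open>2 ^ (n - l)\<close> sets outside the block and \<open>(m * (n + 1) ^ k) ^ k\<close>
    families of entry configurations.\<close>
  define R where "R = Sigma {..<p * q} (\<lambda>w. Pow ({..<n} - J w) \<times> (?H \<rightarrow>\<^sub>E ?C))"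
  have "finite (states M)" "card (states M) = m" using M by (auto simp: mp2s_automaton_def)
  then have C: "finite ?C" "card (?H \<rightarrow>\<^sub>E ?C) = (m * (n + 1) ^ k) ^ k"
    by (simp_all add: finite_configs card_PiE card_configs card_heads k)
  have J: "card ({..<n} - J w) = n - l" if "w < p * q" for w
  proof -
    have J_eq: "J w = {w * l..<Suc w * l}"
      unfolding J_def Suc_in_block_iff[OF l(1), symmetric]
      by (auto simp: block_def less_Suc_eq_le Suc_le_eq)
    have "Suc w * l \<le> p * q * l" using that by (intro mult_le_mono1) simp
    then have "J w \<subseteq> {..<n}" using l(2) J_eq by auto
    then show ?thesis using J_eq by (simp add: card_Diff_subset)
  qed
  have "finite R" unfolding R_def using C(1) by (intro finite_SigmaI) (auto intro: finite_PiE)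
  moreover have "f ` Pow {..<n} \<subseteq> R"
  proof -
    have "entry_config (block_on l p q (W I)) kf kb M (S I) (T I) h \<in> ?C" for I h
      unfolding entry_config_def by (rule config_at_in_configs[OF M in_lists len])
    then show ?thesis using W by (auto simp: f_def R_def)
  qed
  ultimately have "card (f ` Pow {..<n}) \<le> card R" by (rule card_mono)
  also have "card R = (\<Sum>w<p * q. 2 ^ (n - l) * (m * (n + 1) ^ k) ^ k)"
    unfolding R_def using C J
    by (subst card_SigmaI) (auto simp: card_cartesian_product card_Pow finite_PiE intro!: sum.cong)
  also have "\<dots> = 2 ^ (n - l) * (p * q * (m * (n + 1) ^ k) ^ k)" by simp
  also have "\<dots> < 2 ^ (n - l) * 2 ^ l" using small by simp
  also have "\<dots> = card (Pow {..<n})"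
  proof -
    have "1 * l \<le> p * q * l" using p q by (intro mult_le_mono1) simp
    then have "l \<le> n" using l(2) by linarith
    then show ?thesis by (simp add: card_Pow flip: power_add)
  qed
  finally have "\<not> inj_on f (Pow {..<n})" by (rule pigeonhole)
  then obtain I I' where I: "I \<subseteq> {..<n}" "I' \<subseteq> {..<n}" "f I = f I'" "I \<noteq> I'"
    unfolding inj_on_def by blast
  \<comment> \<open>The claim is symmetric in the two colliding sets, so it yields their equality, a
    contradiction.\<close>
  have "A \<subseteq> A'" if A: "A \<subseteq> {..<n}" "f A = f A'" for A A'
  proof
    fix i assume i: "i \<in> A"
    show "i \<in> A'"
    proof (rule ccontr)
      assume i': "i \<notin> A'"
      let ?w = "W A"
      define Sx where "Sx x = (case x of Stream_S \<Rightarrow> S A | Stream_T \<Rightarrow> S A')" for x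
      define Tx where "Tx x = (case x of Stream_S \<Rightarrow> T A | Stream_T \<Rightarrow> T A')" for x
      have same: "W A' = ?w" "A - J ?w = A' - J ?w"
        "\<And>h. h \<in> ?H \<Longrightarrow> entry_config (block_on l p q ?w) kf kb M (S A) (T A) h =
               entry_config (block_on l p q ?w) kf kb M (S A') (T A') h"
        using A(2) unfolding f_def by (auto simp: fun_eq_iff restrict_def split: if_splits)
      have outside: "j \<in> A \<longleftrightarrow> j \<in> A'" if "j div l \<noteq> ?w" for j
        using same(2) that unfolding J_def by blast
      have "accepts kf kb M (Sx Stream_S) (Tx Stream_T)"
      proof (rule accepts_crossed_input[OF M])
        fix x s a assume "a \<in> {1..n} - block_on l p q ?w s"
        then have "stream_of (S A) (T A) s ! (a - 1) = stream_of (S A') (T A') s ! (a - 1)"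
          unfolding S_def T_def using fool_agree[OF l(1) W(1)] outside by blast
        then show "stream_of (Sx x) (Tx x) s ! (a - 1) = stream_of (Sx s) (Tx s) s ! (a - 1)"
          by (cases x; cases s) (simp_all add: Sx_def Tx_def)
      next
        fix x
        show "accepts kf kb M (Sx x) (Tx x)"
          using correct fool_disjoint by (cases x) (simp_all add: Sx_def Tx_def S_def T_def)
        show "never_checks (block_on l p q ?w) kf kb M (Sx x) (Tx x)"
          using W(2)[of A] W(2)[of A'] same(1) by (cases x) (simp_all add: Sx_def Tx_def)
      next
        fix h x y assume "h \<in> ?H"
        then show "entry_config (block_on l p q ?w) kf kb M (Sx x) (Tx x) h =
            entry_config (block_on l p q ?w) kf kb M (Sx y) (Tx y) h"
          using same(3) by (cases x; cases y) (simp_all add: Sx_def Tx_def)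
      next
        fix s a b c assume "a \<in> block_on l p q ?w s" "c \<in> block_on l p q ?w s" "a \<le> b" "b \<le> c"
        then show "b \<in> block_on l p q ?w s" by (cases s) (auto simp: block_def)
      qed (auto simp: Sx_def Tx_def in_lists len split: stream.split)
      then have "set (S A) \<inter> set (T A') = {}" using correct by (simp add: Sx_def Tx_def)
      \<comment> \<open>The sets differ at \<open>i\<close> but agree outside the common block, so
        \<open>i\<close> lies in that block.\<close>
      moreover have "i div l < p * q" using outside[of i] i i' W(1)[of A] by metis
      ultimately show False
        using fool_crossed_not_disjoint[OF l, of i A A'] i i' A(1) unfolding S_def T_def by blast
    qed
  qed
  then show False using I by (metis subset_antisym)
qed

text \<open>With \<open>X\<close> the left-hand side, the hypothesis says that
  \<open>v * (log 2 X + 1)\<close> is at most \<open>n\<close>; the summand 1 pays for rounding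
  \<open>n / v\<close> down.\<close>

lemma record_count_less:
  fixes n m k v :: nat
  assumes "m \<ge> 1" "v \<ge> 1"
    and bound: "(real k)^2 * real v * log 2 (real n + 1) + real k * real v * log 2 (real m)
           + real v * (1 + log 2 (real v)) \<le> real n"
  shows "v * (m * (n + 1) ^ k) ^ k < 2 ^ (n div v)"
proof -
  let ?X = "v * (m * (n + 1) ^ k) ^ k"
  have X: "real ?X > 0" using assms by simp
  have "log 2 (real ?X) = log 2 (real v) + real k * (log 2 (real m) + real k * log 2 (real n + 1))"
    using assms by (simp add: log_mult log_nat_power add.commute)
  then have "real v * (log 2 (real ?X) + 1) \<le> real n"
    using bound by (simp add: algebra_simps power2_eq_square)
  also have "real n < real v * (real (n div v) + 1)"
  proof -
    have "n < v * (n div v + 1)" using assms dividend_less_times_div[of v n] by simp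
    then have "real n < real (v * (n div v + 1))" by linarith
    then show ?thesis by (simp add: algebra_simps)
  qed
  finally have "log 2 (real ?X) < real (n div v)" using assms by simp
  then have "real ?X < 2 powr real (n div v)" using X by (simp add: log_less_iff)
  also have "\<dots> = real (2 ^ (n div v))" by (simp add: powr_realpow)
  finally show ?thesis by linarith
qed

theorem theorem4p6:
  fixes n m kf kb k v :: nat
  assumes "n \<ge> 1" and "m \<ge> 1"
    and "k = 2 * kf + 2 * kb"
    and "v = (kf^2 + kb^2 + 1) * (2 * kf * kb + 1)"
    and "(real k)^2 * real v * log 2 (real n + 1) + real k * real v * log 2 (real m)
           + real v * (1 + log 2 (real v)) \<le> real n"
  shows "\<not> (\<exists>M :: ('q, item) mp2s.
            mp2s_automaton (disj_items n) m kf kb M \<and> solves_disj n kf kb M)"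
proof
  assume "\<exists>M :: ('q, item) mp2s. mp2s_automaton (disj_items n) m kf kb M \<and> solves_disj n kf kb M"
  then obtain M :: "('q, item) mp2s"
    where M: "mp2s_automaton (disj_items n) m kf kb M" "solves_disj n kf kb M" by blast
  have v: "v \<ge> 1" using assms(4) by simp
  have small: "v * (m * (n + 1) ^ k) ^ k < 2 ^ (n div v)"
    by (rule record_count_less[OF assms(2) v assms(5)])
  \<comment> \<open>The block length will be \<open>n div v\<close>; were it 0, the positive number
    of records would be below 1.\<close>
  have "n div v > 0"
  proof (rule ccontr)
    assume "\<not> n div v > 0"
    then have "v * (m * (n + 1) ^ k) ^ k < 1" using small by simp
    then show False using v assms(2) by simp
  qed
  moreover have "v * (n div v) \<le> n" by simp
  ultimately have "2 ^ (n div v) \<le> v * (m * (n + 1) ^ k) ^ k"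
    using solves_disj_record_bound[OF M refl refl, of "n div v" k] assms(3,4) by simp
  then show False using small by simp
qed

end
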